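(* Let $\mathbf{A}=(A;\Rightarrow,\neg)$ be a Sobociński algebra, with derived operations $\wedge,\supset$ and relation $\equiv$. Then $\mathbf{A}$ embeds (as an algebra with operations $\Rightarrow,\neg$) into the Sobociński twist-algebra $[(A;\wedge,\supset)/{\equiv}]^{\bowtie}$ built over the generalized Boolean algebra $(A;\wedge,\supset)/{\equiv}$.
   Context: Let $\mathbf{S}_3=(\{\mathbf 0,\top,\mathbf 1\};\Rightarrow,\neg)$ where $\neg\mathbf 0=\mathbf 1$, $\neg\top=\top$, $\neg\mathbf 1=\mathbf 0$, and $\mathbf 0\Rightarrow y=\mathbf 1$ for all $y$; $\top\Rightarrow\mathbf 0=\mathbf 0$, $\top\Rightarrow\top=\top$, $\top\Rightarrow\mathbf 1=\mathbf 1$; $\mathbf 1\Rightarrow\mathbf 0=\mathbf 0$, $\mathbf 1\Rightarrow\top=\mathbf 0$, $\mathbf 1\Rightarrow\mathbf 1=\mathbf 1$. A Sobociński algebra is a member of the quasi-variety $Q(\mathbf{S}_3)$ generated by $\mathbf{S}_3$. Derived terms: $x\wedge y:=\neg(x\Rightarrow\neg y)$, $|x|:=x\Rightarrow x$, $x\supset y:=x\Rightarrow(x\wedge y)$. Relations: $x\preceq y$ iff $x\supset y=|x\supset y|$; $x\equiv y$ iff $x\preceq y$ and $y\preceq x$. The relation $\equiv$ is a congruence of $(A;\wedge,\supset)$ and the quotient is a generalized Boolean algebra with $\supset$ playing the role of implication. A generalized Boolean algebra is a $0$-free subreduct of a Boolean algebra; equivalently an algebra $(B;\wedge,\vee,\to,1)$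 such that $(B;\wedge,\vee,1)$ is a lattice with greatest element $1$, $x\wedge y\le z$ iff $y\le x\to z$, and $(x\to y)\to x=x$ (here $\vee$ and $1$ are definable from $\wedge,\to$). For a generalized Boolean algebra $\mathbf{B}$, the twist-algebra $\mathbf{B}^{\bowtie}=(B^{\bowtie};\Rightarrow,\neg)$ has universe $B^{\bowtie}=\{(a_1,a_2)\in B\times B: a_1\to a_2=a_2\}$ and operations $\neg(x_1,x_2):=(x_2,x_1)$ and $(x_1,x_2)\Rightarrow(y_1,y_2):=((x_1\to y_1)\wedge(y_2\to x_2),\,x_1\wedge y_2)$. *)

theory Defs
  imports Main
begin

record 'a imp_neg_algebra =
  carrier :: "'a set"
  imp :: "'a \<Rightarrow> 'a \<Rightarrow> 'a" (infixr "\<Rrightarrow>\<index>" 65)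
  neg :: "'a \<Rightarrow> 'a" ("\<sim>\<index> _" [81] 80)

(* Operations are total HOL functions; only their values on the carrier matter. *)
definition algebra :: "'a imp_neg_algebra \<Rightarrow> bool" where
  "algebra A \<longleftrightarrow> carrier A \<noteq> {}
     \<and> (\<forall>x\<in>carrier A. \<forall>y\<in>carrier A. x \<Rrightarrow>\<^bsub>A\<^esub> y \<in> carrier A)
     \<and> (\<forall>x\<in>carrier A. \<sim>\<^bsub>A\<^esub> x \<in> carrier A)"

definition embedding ::
    "'a imp_neg_algebra \<Rightarrow> 'b imp_neg_algebra \<Rightarrow> ('a \<Rightarrow> 'b) \<Rightarrow> bool" where
  "embedding A B h \<longleftrightarrow> h ` carrier A \<subseteq> carrier B \<and> inj_on h (carrier A)
     \<and> (\<forall>x\<in>carrier A. \<forall>y\<in>carrier A. h (x \<Rrightarrow>\<^bsub>A\<^esub> y) = h x \<Rrightarrow>\<^bsub>B\<^esub> h y)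
     \<and> (\<forall>x\<in>carrier A. h (\<sim>\<^bsub>A\<^esub> x) = \<sim>\<^bsub>B\<^esub> h x)"

definition embeds :: "'a imp_neg_algebra \<Rightarrow> 'b imp_neg_algebra \<Rightarrow> bool" where
  "embeds A B \<longleftrightarrow> (\<exists>h. embedding A B h)"


datatype tm = Var nat | Imp tm tm | Neg tm

primrec eval :: "'a imp_neg_algebra \<Rightarrow> (nat \<Rightarrow> 'a) \<Rightarrow> tm \<Rightarrow> 'a" where
  "eval A v (Var n) = v n"
| "eval A v (Imp s t) = eval A v s \<Rrightarrow>\<^bsub>A\<^esub> eval A v t"
| "eval A v (Neg t) = \<sim>\<^bsub>A\<^esub> eval A v t"

type_synonym equation = "tm \<times> tm"

(* (es, e) stands for the quasi-identity "if all equations in es hold, then e holds". *)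
type_synonym quasi_identity = "equation list \<times> equation"

definition holds :: "'a imp_neg_algebra \<Rightarrow> (nat \<Rightarrow> 'a) \<Rightarrow> equation \<Rightarrow> bool" where
  "holds A v e \<longleftrightarrow> eval A v (fst e) = eval A v (snd e)"

definition valid :: "'a imp_neg_algebra \<Rightarrow> quasi_identity \<Rightarrow> bool" where
  "valid A q \<longleftrightarrow> (\<forall>v. range v \<subseteq> carrier A \<longrightarrow>
     (\<forall>e\<in>set (fst q). holds A v e) \<longrightarrow> holds A v (snd q))"

(* The least quasi-variety containing S is the class of all models of the
   quasi-identities valid in S. *)
definition in_quasivariety_of :: "'a imp_neg_algebra \<Rightarrow> 'b imp_neg_algebra \<Rightarrow> bool" where
  "in_quasivariety_of A S \<longleftrightarrow> algebra A \<and> (\<forall>q. valid S q \<longrightarrow> valid A q)"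


datatype three = Zero | Top | One

fun neg3 :: "three \<Rightarrow> three" where
  "neg3 Zero = One"
| "neg3 Top = Top"
| "neg3 One = Zero"

fun imp3 :: "three \<Rightarrow> three \<Rightarrow> three" where
  "imp3 Zero y = One"
| "imp3 Top Zero = Zero"
| "imp3 Top Top = Top"
| "imp3 Top One = One"
| "imp3 One Zero = Zero"
| "imp3 One Top = Zero"
| "imp3 One One = One"

definition S3 :: "three imp_neg_algebra" where
  "S3 = \<lparr>carrier = UNIV, imp = imp3, neg = neg3\<rparr>"

definition sobocinski_algebra :: "'a imp_neg_algebra \<Rightarrow> bool" where
  "sobocinski_algebra A \<longleftrightarrow> in_quasivariety_of A S3"


definition wedge :: "'a imp_neg_algebra \<Rightarrow> 'a \<Rightarrow> 'a \<Rightarrow> 'a" where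
  "wedge A x y = \<sim>\<^bsub>A\<^esub> (x \<Rrightarrow>\<^bsub>A\<^esub> \<sim>\<^bsub>A\<^esub> y)"

definition modulus :: "'a imp_neg_algebra \<Rightarrow> 'a \<Rightarrow> 'a" where
  "modulus A x = x \<Rrightarrow>\<^bsub>A\<^esub> x"

definition hook :: "'a imp_neg_algebra \<Rightarrow> 'a \<Rightarrow> 'a \<Rightarrow> 'a" where
  "hook A x y = x \<Rrightarrow>\<^bsub>A\<^esub> wedge A x y"

definition preceq :: "'a imp_neg_algebra \<Rightarrow> 'a \<Rightarrow> 'a \<Rightarrow> bool" where
  "preceq A x y \<longleftrightarrow> hook A x y = modulus A (hook A x y)"

definition eqv :: "'a imp_neg_algebra \<Rightarrow> ('a \<times> 'a) set" where
  "eqv A = {(x, y). x \<in> carrier A \<and> y \<in> carrier A \<and> preceq A x y \<and> preceq A y x}"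


record 'b meet_imp_algebra =
  bcarrier :: "'b set"
  bmeet :: "'b \<Rightarrow> 'b \<Rightarrow> 'b" (infixl "\<sqinter>\<index>" 70)
  bimp :: "'b \<Rightarrow> 'b \<Rightarrow> 'b" (infixr "\<rightarrow>\<index>" 65)

definition ble :: "'b meet_imp_algebra \<Rightarrow> 'b \<Rightarrow> 'b \<Rightarrow> bool" where
  "ble B x y \<longleftrightarrow> x \<sqinter>\<^bsub>B\<^esub> y = x"

locale gen_boolean_with =
  fixes B :: "'b meet_imp_algebra" (structure)
    and join :: "'b \<Rightarrow> 'b \<Rightarrow> 'b"
    and one :: 'b
  assumes meet_closed: "\<lbrakk>x \<in> bcarrier B; y \<in> bcarrier B\<rbrakk> \<Longrightarrow> x \<sqinter> y \<in> bcarrier B"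
    and join_closed: "\<lbrakk>x \<in> bcarrier B; y \<in> bcarrier B\<rbrakk> \<Longrightarrow> join x y \<in> bcarrier B"
    and imp_closed: "\<lbrakk>x \<in> bcarrier B; y \<in> bcarrier B\<rbrakk> \<Longrightarrow> x \<rightarrow> y \<in> bcarrier B"
    and one_closed: "one \<in> bcarrier B"
    and meet_commute: "\<lbrakk>x \<in> bcarrier B; y \<in> bcarrier B\<rbrakk> \<Longrightarrow> x \<sqinter> y = y \<sqinter> x"
    and join_commute: "\<lbrakk>x \<in> bcarrier B; y \<in> bcarrier B\<rbrakk> \<Longrightarrow> join x y = join y x"
    and meet_assoc: "\<lbrakk>x \<in> bcarrier B; y \<in> bcarrier B; z \<in> bcarrier B\<rbrakk>
          \<Longrightarrow> (x \<sqinter> y) \<sqinter> z = x \<sqinter> (y \<sqinter> z)"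
    and join_assoc: "\<lbrakk>x \<in> bcarrier B; y \<in> bcarrier B; z \<in> bcarrier B\<rbrakk>
          \<Longrightarrow> join (join x y) z = join x (join y z)"
    and meet_absorb: "\<lbrakk>x \<in> bcarrier B; y \<in> bcarrier B\<rbrakk> \<Longrightarrow> x \<sqinter> join x y = x"
    and join_absorb: "\<lbrakk>x \<in> bcarrier B; y \<in> bcarrier B\<rbrakk> \<Longrightarrow> join x (x \<sqinter> y) = x"
    and one_greatest: "x \<in> bcarrier B \<Longrightarrow> ble B x one"
    and residuation: "\<lbrakk>x \<in> bcarrier B; y \<in> bcarrier B; z \<in> bcarrier B\<rbrakk>
          \<Longrightarrow> ble B (x \<sqinter> y) z \<longleftrightarrow> ble B y (x \<rightarrow> z)"
    and peirce: "\<lbrakk>x \<in> bcarrier B; y \<in> bcarrier B\<rbrakk> \<Longrightarrow> (x \<rightarrow> y) \<rightarrow> x = x"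

(* Join and 1 are determined by meet and implication, so they are not part of the signature. *)
definition gen_boolean_algebra :: "'b meet_imp_algebra \<Rightarrow> bool" where
  "gen_boolean_algebra B \<longleftrightarrow> (\<exists>join one. gen_boolean_with B join one)"

definition twist :: "'b meet_imp_algebra \<Rightarrow> ('b \<times> 'b) imp_neg_algebra" where
  "twist B = \<lparr>
     carrier = {(a1, a2). a1 \<in> bcarrier B \<and> a2 \<in> bcarrier B \<and> a1 \<rightarrow>\<^bsub>B\<^esub> a2 = a2},
     imp = (\<lambda>(x1, x2) (y1, y2).
              ((x1 \<rightarrow>\<^bsub>B\<^esub> y1) \<sqinter>\<^bsub>B\<^esub> (y2 \<rightarrow>\<^bsub>B\<^esub> x2), x1 \<sqinter>\<^bsub>B\<^esub> y2)),
     neg = (\<lambda>(x1, x2). (x2, x1))\<rparr>"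


definition meet_imp_reduct :: "'a imp_neg_algebra \<Rightarrow> 'a meet_imp_algebra" where
  "meet_imp_reduct A = \<lparr>bcarrier = carrier A, bmeet = wedge A, bimp = hook A\<rparr>"

definition congruence :: "'b meet_imp_algebra \<Rightarrow> ('b \<times> 'b) set \<Rightarrow> bool" where
  "congruence B r \<longleftrightarrow> equiv (bcarrier B) r
     \<and> (\<lambda>x y. r `` {x \<sqinter>\<^bsub>B\<^esub> y}) respects2 r
     \<and> (\<lambda>x y. r `` {x \<rightarrow>\<^bsub>B\<^esub> y}) respects2 r"

(* For a congruence r, the union over all representatives is a single class. *)
definition quotient_algebra ::
    "'b meet_imp_algebra \<Rightarrow> ('b \<times> 'b) set \<Rightarrow> 'b set meet_imp_algebra" where
  "quotient_algebra B r = \<lparr>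
     bcarrier = bcarrier B // r,
     bmeet = (\<lambda>X Y. \<Union>x\<in>X. \<Union>y\<in>Y. r `` {x \<sqinter>\<^bsub>B\<^esub> y}),
     bimp = (\<lambda>X Y. \<Union>x\<in>X. \<Union>y\<in>Y. r `` {x \<rightarrow>\<^bsub>B\<^esub> y})\<rparr>"

end

theory Submission
  imports Defs
begin

text \<open>
  Membership in the quasi-variety of \<open>S3\<close> means that every quasi-identity of the three-element
  algebra is inherited by \<open>A\<close>, so the whole theorem is reduced to facts about \<open>S3\<close> once everything
  in sight is phrased by equations. The relation \<open>preceq\<close> is given by an equation, and in \<open>S3\<close> it
  says that \<open>a \<noteq> Zero\<close> implies \<open>b \<noteq> Zero\<close>. Being different from \<open>Zero\<close> thus plays
  the role of truth: it turns \<open>wedge\<close> into conjunction and \<open>hook\<close> into implication, and \<open>eqv\<close> relates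
  two elements when they have the same truth value.

  Consequently an implication between equivalences that is correct for truth values in \<open>S3\<close>
  is correct for \<open>eqv A\<close> (lemma \<open>eqv_transfer\<close>). Instances of it show that \<open>eqv A\<close> is a congruence,
  that the quotient obeys the laws of generalized Boolean algebras, which are classical tautologies,
  and that the twist product is closed under its operations.

  The embedding is \<open>x \<mapsto> ([x], [\<sim>x])\<close>. It lands in the twist product and preserves the operations
  by the same principle. It is injective because in \<open>S3\<close> an element is determined by the truth values
  of itself and of its negation: \<open>Zero\<close>, \<open>One\<close> and \<open>Top\<close> are the pairs (false, true), (true, false)
  and (true, true). This, too, is a quasi-identity.
\<close>

section \<open>Truth values in the three-element algebra\<close>

lemma S3_simps [simp]:
  "carrier S3 = UNIV" "imp S3 = imp3" "neg S3 = neg3"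
  by (simp_all add: S3_def)

lemma wedge_S3_eq_Zero [simp]: "wedge S3 a b = Zero \<longleftrightarrow> a = Zero \<or> b = Zero"
  by (cases a; cases b) (simp_all add: wedge_def)

lemma hook_S3_eq_Zero [simp]: "hook S3 a b = Zero \<longleftrightarrow> a \<noteq> Zero \<and> b = Zero"
  by (cases a; cases b) (simp_all add: hook_def wedge_def)

text \<open>A value \<open>c\<close> satisfies \<open>c = (c \<Rrightarrow> c)\<close> exactly if it is \<open>Top\<close> or \<open>One\<close>, so the equation that
  defines the preorder asserts the truth of \<open>hook S3 a b\<close>.\<close>
lemma preceq_S3 [simp]: "preceq S3 a b \<longleftrightarrow> (a \<noteq> Zero \<longrightarrow> b \<noteq> Zero)"
  by (cases a; cases b) (simp_all add: preceq_def modulus_def hook_def wedge_def)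

text \<open>The truth value of \<open>a \<Rrightarrow> b\<close> is not a function of the truth values of \<open>a\<close> and \<open>b\<close>: the
  values \<open>One\<close> and \<open>Top\<close> are both true, but \<open>imp3 One Top = Zero\<close>. The truth of the negations has
  to be taken into account as well, which is what the second component of the twist product records.\<close>
lemma imp3_eq_Zero:
  "imp3 a b = Zero \<longleftrightarrow> (a \<noteq> Zero \<and> b = Zero) \<or> (neg3 b \<noteq> Zero \<and> neg3 a = Zero)"
  by (cases a; cases b) simp_all

section \<open>Transfer of two-valued reasoning\<close>

definition wedge_tm :: "tm \<Rightarrow> tm \<Rightarrow> tm" where
  "wedge_tm s t = Neg (Imp s (Neg t))"

definition hook_tm :: "tm \<Rightarrow> tm \<Rightarrow> tm" where
  "hook_tm s t = Imp s (wedge_tm s t)"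

definition preceq_eqn :: "tm \<Rightarrow> tm \<Rightarrow> equation" where
  "preceq_eqn s t = (hook_tm s t, Imp (hook_tm s t) (hook_tm s t))"

lemma eval_wedge_tm [simp]: "eval A v (wedge_tm s t) = wedge A (eval A v s) (eval A v t)"
  by (simp add: wedge_tm_def wedge_def)

lemma eval_hook_tm [simp]: "eval A v (hook_tm s t) = hook A (eval A v s) (eval A v t)"
  by (simp add: hook_tm_def hook_def)

lemma holds_preceq_eqn [simp]:
  "holds A v (preceq_eqn s t) \<longleftrightarrow> preceq A (eval A v s) (eval A v t)"
  by (simp add: preceq_eqn_def holds_def preceq_def modulus_def)

lemma holds_Var [simp]: "holds A v (Var m, Var n) \<longleftrightarrow> v m = v n"
  by (simp add: holds_def)

definition eqv_eqns :: "tm \<times> tm \<Rightarrow> equation list" where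
  "eqv_eqns p = [preceq_eqn (fst p) (snd p), preceq_eqn (snd p) (fst p)]"

text \<open>Repeating the last entry makes every assignment total, so that finitely many values in the
  carrier suffice.\<close>
definition env :: "'a list \<Rightarrow> nat \<Rightarrow> 'a" where
  "env xs n = (if n < length xs then xs ! n else last xs)"

lemma range_env: "\<lbrakk>xs \<noteq> []; set xs \<subseteq> C\<rbrakk> \<Longrightarrow> range (env xs) \<subseteq> C"
  by (auto simp: env_def subset_iff)

lemma eval_closed: "\<lbrakk>algebra A; range v \<subseteq> carrier A\<rbrakk> \<Longrightarrow> eval A v t \<in> carrier A"
  by (induction t) (auto simp: algebra_def)

lemma quasi_identity_transfer:
  assumes "sobocinski_algebra A" "valid S3 (es, e)" "range v \<subseteq> carrier A"
    and "\<And>d. d \<in> set es \<Longrightarrow> holds A v d"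
  shows "holds A v e"
proof -
  have "valid A (es, e)"
    using assms(1,2) unfolding sobocinski_algebra_def in_quasivariety_of_def by blast
  then show ?thesis
    using assms(3,4) by (simp add: valid_def)
qed

definition same_truth :: "(nat \<Rightarrow> three) \<Rightarrow> tm \<times> tm \<Rightarrow> bool" where
  "same_truth v p \<longleftrightarrow> (eval S3 v (fst p) = Zero \<longleftrightarrow> eval S3 v (snd p) = Zero)"

definition equivalent_in :: "'a imp_neg_algebra \<Rightarrow> 'a list \<Rightarrow> tm \<times> tm \<Rightarrow> bool" where
  "equivalent_in A xs p \<longleftrightarrow> (eval A (env xs) (fst p), eval A (env xs) (snd p)) \<in> eqv A"

text \<open>An equivalence is a pair of equations, so an implication between equivalences is a pair of
  quasi-identities, which only have to be checked on truth values in \<open>S3\<close>.\<close>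
lemma eqv_transfer:
  assumes A: "sobocinski_algebra A" and xs: "xs \<noteq> []" "set xs \<subseteq> carrier A"
    and prems: "\<forall>p\<in>set ps. equivalent_in A xs p"
    and S3: "\<And>v. \<forall>p\<in>set ps. same_truth v p \<Longrightarrow> same_truth v q"
  shows "equivalent_in A xs q"
proof -
  let ?es = "concat (map eqv_eqns ps)"
  have ran: "range (env xs) \<subseteq> carrier A"
    using range_env xs by blast
  have alg: "algebra A"
    using A by (simp add: sobocinski_algebra_def in_quasivariety_of_def)
  have hyp: "holds A (env xs) d" if "d \<in> set ?es" for d
    using that prems by (auto simp: eqv_eqns_def equivalent_in_def eqv_def)
  have "holds A (env xs) e" if e: "e \<in> set (eqv_eqns q)" for e
  proof (rule quasi_identity_transfer[OF A _ ran hyp])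
    show "valid S3 (?es, e)"
      unfolding valid_def
    proof (intro allI impI)
      fix v assume "\<forall>d\<in>set (fst (?es, e)). holds S3 v d"
      then have "\<forall>p\<in>set ps. same_truth v p"
        by (auto simp: eqv_eqns_def same_truth_def)
      then have "same_truth v q"
        by (rule S3)
      then show "holds S3 v (snd (?es, e))"
        using e by (auto simp: eqv_eqns_def same_truth_def)
    qed
  qed
  then have "\<forall>e\<in>set (eqv_eqns q). holds A (env xs) e"
    by blast
  then show ?thesis
    using eval_closed[OF alg ran] by (simp add: eqv_eqns_def equivalent_in_def eqv_def)
qed

section \<open>The quotient of a Sobocinski algebra\<close>

locale sobocinski =
  fixes A :: "'a imp_neg_algebra"
  assumes sobocinski: "sobocinski_algebra A"
begin

abbreviation cls :: "'a \<Rightarrow> 'a set" where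
  "cls x \<equiv> eqv A `` {x}"

abbreviation quot :: "'a set meet_imp_algebra" where
  "quot \<equiv> quotient_algebra (meet_imp_reduct A) (eqv A)"

lemma is_algebra: "algebra A"
  using sobocinski by (simp add: sobocinski_algebra_def in_quasivariety_of_def)

lemma imp_in [simp]: "\<lbrakk>x \<in> carrier A; y \<in> carrier A\<rbrakk> \<Longrightarrow> imp A x y \<in> carrier A"
  using is_algebra by (simp add: algebra_def)

lemma neg_in [simp]: "x \<in> carrier A \<Longrightarrow> neg A x \<in> carrier A"
  using is_algebra by (simp add: algebra_def)

lemma wedge_in [simp]: "\<lbrakk>x \<in> carrier A; y \<in> carrier A\<rbrakk> \<Longrightarrow> wedge A x y \<in> carrier A"
  by (simp add: wedge_def)

lemma hook_in [simp]: "\<lbrakk>x \<in> carrier A; y \<in> carrier A\<rbrakk> \<Longrightarrow> hook A x y \<in> carrier A"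
  by (simp add: hook_def)

lemmas transfer = eqv_transfer[OF sobocinski]
lemmas transfer_simps = equivalent_in_def same_truth_def env_def

lemma equiv_eqv: "equiv (carrier A) (eqv A)"
proof (rule equivI)
  show "refl_on (carrier A) (eqv A)"
  proof (rule refl_onI)
    fix x assume "x \<in> carrier A"
    then show "(x, x) \<in> eqv A"
      using transfer[of "[x]" "[]" "(Var 0, Var 0)"] by (simp add: transfer_simps)
  qed
  show "sym (eqv A)"
    by (auto simp: sym_def eqv_def)
  show "trans (eqv A)"
  proof (rule transI)
    fix x y z assume "(x, y) \<in> eqv A" "(y, z) \<in> eqv A"
    moreover from this have "x \<in> carrier A" "y \<in> carrier A" "z \<in> carrier A"
      by (auto simp: eqv_def)
    ultimately show "(x, z) \<in> eqv A"
      using transfer[of "[x, y, z]" "[(Var 0, Var 1), (Var 1, Var 2)]" "(Var 0, Var 2)"]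
      by (simp add: transfer_simps)
  qed
qed (auto simp: eqv_def)

lemma cls_eq_iff:
  "\<lbrakk>x \<in> carrier A; y \<in> carrier A\<rbrakk> \<Longrightarrow> cls x = cls y \<longleftrightarrow> (x, y) \<in> eqv A"
  using eq_equiv_class_iff[OF equiv_eqv] .

lemma eqv_binary:
  assumes "(x, x') \<in> eqv A" "(y, y') \<in> eqv A"
  shows eqv_wedge: "(wedge A x y, wedge A x' y') \<in> eqv A"
    and eqv_hook: "(hook A x y, hook A x' y') \<in> eqv A"
proof -
  have "x \<in> carrier A" "x' \<in> carrier A" "y \<in> carrier A" "y' \<in> carrier A"
    using assms by (auto simp: eqv_def)
  then show "(wedge A x y, wedge A x' y') \<in> eqv A" "(hook A x y, hook A x' y') \<in> eqv A"
    using assms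
      transfer[of "[x, x', y, y']" "[(Var 0, Var 1), (Var 2, Var 3)]"
        "(wedge_tm (Var 0) (Var 2), wedge_tm (Var 1) (Var 3))"]
      transfer[of "[x, x', y, y']" "[(Var 0, Var 1), (Var 2, Var 3)]"
        "(hook_tm (Var 0) (Var 2), hook_tm (Var 1) (Var 3))"]
    by (simp_all add: transfer_simps)
qed

lemma respects2_wedge: "(\<lambda>x y. cls (wedge A x y)) respects2 eqv A"
  and respects2_hook: "(\<lambda>x y. cls (hook A x y)) respects2 eqv A"
  unfolding congruent2_def
  by (auto intro!: equiv_class_eq[OF equiv_eqv] eqv_wedge eqv_hook simp del: Image_singleton_iff)

lemma congruence_eqv: "congruence (meet_imp_reduct A) (eqv A)"
  using equiv_eqv respects2_wedge respects2_hook
  by (simp add: congruence_def meet_imp_reduct_def)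

lemma quot_carrier: "bcarrier quot = cls ` carrier A"
  by (auto simp: quotient_algebra_def meet_imp_reduct_def quotient_def)

lemma quot_cases:
  assumes "X \<in> bcarrier quot"
  obtains x where "x \<in> carrier A" "X = cls x"
  using assms unfolding quot_carrier by blast

lemma cls_in_quot [simp]: "x \<in> carrier A \<Longrightarrow> cls x \<in> bcarrier quot"
  by (simp add: quot_carrier)

lemma quot_meet [simp]:
  "\<lbrakk>x \<in> carrier A; y \<in> carrier A\<rbrakk> \<Longrightarrow> bmeet quot (cls x) (cls y) = cls (wedge A x y)"
  using UN_equiv_class2[OF equiv_eqv equiv_eqv respects2_wedge]
  by (simp add: quotient_algebra_def meet_imp_reduct_def)

lemma quot_imp [simp]:
  "\<lbrakk>x \<in> carrier A; y \<in> carrier A\<rbrakk> \<Longrightarrow> bimp quot (cls x) (cls y) = cls (hook A x y)"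
  using UN_equiv_class2[OF equiv_eqv equiv_eqv respects2_hook]
  by (simp add: quotient_algebra_def meet_imp_reduct_def)

text \<open>The form of the transfer principle used for the quotient: each identity of classes is the
  evaluation of a pair of terms, and truth-value reasoning decides it.\<close>
lemma cls_transfer:
  assumes xs: "xs \<noteq> []" "set xs \<subseteq> carrier A"
    and prems: "\<forall>(s, t)\<in>set ps. cls (eval A (env xs) s) = cls (eval A (env xs) t)"
    and S3: "\<And>v. \<forall>p\<in>set ps. same_truth v p \<Longrightarrow> same_truth v (s, t)"
  shows "cls (eval A (env xs) s) = cls (eval A (env xs) t)"
proof -
  have cls_iff: "cls (eval A (env xs) a) = cls (eval A (env xs) b) \<longleftrightarrow> equivalent_in A xs (a, b)"
    for a b
    using eval_closed[OF is_algebra range_env[OF xs]] by (simp add: cls_eq_iff equivalent_in_def)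
  have "\<forall>p\<in>set ps. equivalent_in A xs p"
    using prems unfolding cls_iff by auto
  then have "equivalent_in A xs (s, t)"
    using transfer[OF xs] S3 by blast
  then show ?thesis
    unfolding cls_iff .
qed

section \<open>The Boolean laws\<close>

text \<open>Classically a disjunction is \<open>(p \<longrightarrow> q) \<longrightarrow> q\<close>, and any instance of \<open>p \<longrightarrow> p\<close> is
  the true proposition.\<close>
lemma gen_boolean_quot: "gen_boolean_algebra quot"
proof -
  obtain c where c: "c \<in> carrier A"
    using is_algebra by (auto simp: algebra_def)
  let ?join = "\<lambda>X Y. bimp quot (bimp quot X Y) Y"
  let ?one = "cls (hook A c c)"
  let ?x = "Var 0" and ?y = "Var 1" and ?z = "Var 2"
  have meet_commute: "cls (wedge A x y) = cls (wedge A y x)"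
    if "x \<in> carrier A" "y \<in> carrier A" for x y
    using that cls_transfer[of "[x, y]" "[]"
        "wedge_tm ?x ?y"
        "wedge_tm ?y ?x"]
    by (auto simp: transfer_simps)
  have join_commute: "cls (hook A (hook A x y) y) = cls (hook A (hook A y x) x)"
    if "x \<in> carrier A" "y \<in> carrier A" for x y
    using that cls_transfer[of "[x, y]" "[]"
        "hook_tm (hook_tm ?x ?y) ?y"
        "hook_tm (hook_tm ?y ?x) ?x"]
    by (auto simp: transfer_simps)
  have meet_assoc: "cls (wedge A (wedge A x y) z) = cls (wedge A x (wedge A y z))"
    if "x \<in> carrier A" "y \<in> carrier A" "z \<in> carrier A" for x y z
    using that cls_transfer[of "[x, y, z]" "[]"
        "wedge_tm (wedge_tm ?x ?y) ?z"
        "wedge_tm ?x (wedge_tm ?y ?z)"]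
    by (auto simp: transfer_simps)
  have join_assoc: "cls (hook A (hook A (hook A (hook A x y) y) z) z) = cls (hook A (hook A x (hook A (hook A y z) z)) (hook A (hook A y z) z))"
    if "x \<in> carrier A" "y \<in> carrier A" "z \<in> carrier A" for x y z
    using that cls_transfer[of "[x, y, z]" "[]"
        "hook_tm (hook_tm (hook_tm (hook_tm ?x ?y) ?y) ?z) ?z"
        "hook_tm (hook_tm ?x (hook_tm (hook_tm ?y ?z) ?z)) (hook_tm (hook_tm ?y ?z) ?z)"]
    by (auto simp: transfer_simps)
  have meet_absorb: "cls (wedge A x (hook A (hook A x y) y)) = cls x"
    if "x \<in> carrier A" "y \<in> carrier A" for x y
    using that cls_transfer[of "[x, y]" "[]"
        "wedge_tm ?x (hook_tm (hook_tm ?x ?y) ?y)"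
        "?x"]
    by (auto simp: transfer_simps)
  have join_absorb: "cls (hook A (hook A x (wedge A x y)) (wedge A x y)) = cls x"
    if "x \<in> carrier A" "y \<in> carrier A" for x y
    using that cls_transfer[of "[x, y]" "[]"
        "hook_tm (hook_tm ?x (wedge_tm ?x ?y)) (wedge_tm ?x ?y)"
        "?x"]
    by (auto simp: transfer_simps)
  have peirce: "cls (hook A (hook A x y) x) = cls x"
    if "x \<in> carrier A" "y \<in> carrier A" for x y
    using that cls_transfer[of "[x, y]" "[]"
        "hook_tm (hook_tm ?x ?y) ?x"
        "?x"]
    by (auto simp: transfer_simps)
  have greatest: "cls (wedge A x (hook A c c)) = cls x"
    if "x \<in> carrier A" for x
    using that c cls_transfer[of "[x, c]" "[]"
        "wedge_tm ?x (hook_tm ?y ?y)"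
        "?x"]
    by (auto simp: transfer_simps)
  have residuation: "cls (wedge A (wedge A x y) z) = cls (wedge A x y)
      \<longleftrightarrow> cls (wedge A y (hook A x z)) = cls y"
    if "x \<in> carrier A" "y \<in> carrier A" "z \<in> carrier A" for x y z
    using that
      cls_transfer[of "[x, y, z]" "[(wedge_tm (wedge_tm ?x ?y) ?z, wedge_tm ?x ?y)]"
        "wedge_tm ?y (hook_tm ?x ?z)" ?y]
      cls_transfer[of "[x, y, z]" "[(wedge_tm ?y (hook_tm ?x ?z), ?y)]"
        "wedge_tm (wedge_tm ?x ?y) ?z" "wedge_tm ?x ?y"]
    by (auto simp: transfer_simps)
  have "gen_boolean_with quot ?join ?one"
    by (unfold_locales; (elim quot_cases)?; simp add: ble_def c;
      intro meet_commute join_commute meet_assoc join_assoc meet_absorb join_absorb peirce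
        greatest residuation; assumption)
  then show ?thesis
    unfolding gen_boolean_algebra_def by blast
qed

section \<open>The twist product and the embedding\<close>

lemma in_twist_quot_iff:
  "P \<in> carrier (twist quot) \<longleftrightarrow>
    (\<exists>a\<in>carrier A. \<exists>b\<in>carrier A. P = (cls a, cls b) \<and> cls (hook A a b) = cls b)"
  by (auto simp: twist_def quot_carrier) blast

text \<open>The side condition on a pair \<open>(a, b)\<close> states classically that \<open>a\<close> or \<open>b\<close> is true, which is
  symmetric in \<open>a\<close> and \<open>b\<close>.\<close>
lemma algebra_twist: "algebra (twist quot)"
proof -
  let ?a = "Var 0" and ?b = "Var 1" and ?c = "Var 2" and ?d = "Var 3"
  have imp: "imp (twist quot) P Q \<in> carrier (twist quot)"
    if "P \<in> carrier (twist quot)" "Q \<in> carrier (twist quot)" for P Q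
  proof -
    from that obtain a b c d where
      P: "a \<in> carrier A" "b \<in> carrier A" "P = (cls a, cls b)" "cls (hook A a b) = cls b" and
      Q: "c \<in> carrier A" "d \<in> carrier A" "Q = (cls c, cls d)" "cls (hook A c d) = cls d"
      unfolding in_twist_quot_iff by blast
    let ?l = "wedge A (hook A a c) (hook A d b)" and ?r = "wedge A a d"
    have "imp (twist quot) P Q = (cls ?l, cls ?r)"
      using P Q by (simp add: twist_def)
    moreover have "cls (hook A ?l ?r) = cls ?r"
      using P Q cls_transfer[of "[a, b, c, d]" "[(hook_tm ?a ?b, ?b), (hook_tm ?c ?d, ?d)]"
          "hook_tm (wedge_tm (hook_tm ?a ?c) (hook_tm ?d ?b)) (wedge_tm ?a ?d)" "wedge_tm ?a ?d"]
      by (auto simp: transfer_simps)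
    moreover have "?l \<in> carrier A" "?r \<in> carrier A"
      using P Q by simp_all
    ultimately show ?thesis
      unfolding in_twist_quot_iff by blast
  qed
  have neg: "neg (twist quot) P \<in> carrier (twist quot)" if "P \<in> carrier (twist quot)" for P
  proof -
    from that obtain a b where
      P: "a \<in> carrier A" "b \<in> carrier A" "P = (cls a, cls b)" "cls (hook A a b) = cls b"
      unfolding in_twist_quot_iff by blast
    have "neg (twist quot) P = (cls b, cls a)"
      using P by (simp add: twist_def)
    moreover have "cls (hook A b a) = cls a"
      using P cls_transfer[of "[a, b]" "[(hook_tm ?a ?b, ?b)]" "hook_tm ?b ?a" ?a]
      by (auto simp: transfer_simps)
    ultimately show ?thesis
      using P unfolding in_twist_quot_iff by blast
  qed
  have "carrier (twist quot) \<noteq> {}"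
  proof -
    obtain c where c: "c \<in> carrier A"
      using is_algebra by (auto simp: algebra_def)
    then have "cls (hook A c (hook A c c)) = cls (hook A c c)"
      using cls_transfer[of "[c]" "[]" "hook_tm ?a (hook_tm ?a ?a)" "hook_tm ?a ?a"]
      by (auto simp: transfer_simps)
    then have "(cls c, cls (hook A c c)) \<in> carrier (twist quot)"
      unfolding in_twist_quot_iff using c hook_in by blast
    then show ?thesis
      by blast
  qed
  then show ?thesis
    using imp neg by (simp add: algebra_def)
qed

text \<open>This is where \<open>\<sim>\<close> does its work: \<open>eqv\<close> alone identifies \<open>Top\<close> with \<open>One\<close> in \<open>S3\<close>, and of these
  two only \<open>Top\<close> has a true negation.\<close>
lemma eq_if_eqv_neg:
  assumes "(x, y) \<in> eqv A" "(neg A x, neg A y) \<in> eqv A"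
  shows "x = y"
proof -
  let ?es = "eqv_eqns (Var 0, Var 1) @ eqv_eqns (Neg (Var 0), Neg (Var 1))"
  have xy: "x \<in> carrier A" "y \<in> carrier A"
    using assms by (auto simp: eqv_def)
  have "holds A (env [x, y]) (Var 0, Var 1)"
  proof (rule quasi_identity_transfer[OF sobocinski])
    have truths: "a = b" if "a = Zero \<longleftrightarrow> b = Zero" "neg3 a = Zero \<longleftrightarrow> neg3 b = Zero" for a b
      using that by (cases a; cases b) simp_all
    show "valid S3 (?es, (Var 0, Var 1))"
      unfolding valid_def
    proof (intro allI impI)
      fix v assume "\<forall>d\<in>set (fst (?es, (Var 0, Var 1))). holds S3 v d"
      then have "v 0 = v 1"
        by (intro truths) (auto simp: eqv_eqns_def)
      then show "holds S3 v (snd (?es, (Var 0, Var 1)))"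
        by simp
    qed
    show "range (env [x, y]) \<subseteq> carrier A"
      using xy by (intro range_env) auto
    show "holds A (env [x, y]) d" if "d \<in> set ?es" for d
      using that assms by (auto simp: eqv_eqns_def eqv_def env_def)
  qed
  then show ?thesis
    by (simp add: holds_def env_def)
qed

lemma embedding_twist: "embedding A (twist quot) (\<lambda>x. (cls x, cls (neg A x)))"
proof -
  let ?x = "Var 0" and ?y = "Var 1"
  have neg3_cases: "neg3 a = Zero \<longleftrightarrow> a = One" "neg3 a = One \<longleftrightarrow> a = Zero" for a
    by (cases a; simp)+
  have One_true: "a \<noteq> Zero \<and> a = One \<longleftrightarrow> a = One" for a
    by auto
  have side_condition: "cls (hook A x (neg A x)) = cls (neg A x)" if "x \<in> carrier A" for x
    using that cls_transfer[of "[x]" "[]" "hook_tm ?x (Neg ?x)" "Neg ?x"]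
    by (auto simp: transfer_simps neg3_cases One_true)
  have inj: "x = y"
    if "x \<in> carrier A" "y \<in> carrier A" "cls x = cls y" "cls (neg A x) = cls (neg A y)" for x y
    using that eq_if_eqv_neg by (simp add: cls_eq_iff)
  have imp1: "cls (imp A x y) = cls (wedge A (hook A x y) (hook A (neg A y) (neg A x)))"
    if "x \<in> carrier A" "y \<in> carrier A" for x y
    using that cls_transfer[of "[x, y]" "[]" "Imp ?x ?y"
        "wedge_tm (hook_tm ?x ?y) (hook_tm (Neg ?y) (Neg ?x))"]
    by (auto simp: transfer_simps imp3_eq_Zero)
  have imp2: "cls (neg A (imp A x y)) = cls (wedge A x (neg A y))"
    if "x \<in> carrier A" "y \<in> carrier A" for x y
  proof -
    have "imp3 a b = One \<longleftrightarrow> a = Zero \<or> b = One" for a b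
      by (cases a; cases b) simp_all
    then show ?thesis
      using that cls_transfer[of "[x, y]" "[]" "Neg (Imp ?x ?y)" "wedge_tm ?x (Neg ?y)"]
      by (auto simp: transfer_simps neg3_cases)
  qed
  have neg: "cls (neg A (neg A x)) = cls x" if "x \<in> carrier A" for x
    using that cls_transfer[of "[x]" "[]" "Neg (Neg ?x)" ?x]
    by (auto simp: transfer_simps neg3_cases)
  have mem: "(cls x, cls (neg A x)) \<in> carrier (twist quot)" if "x \<in> carrier A" for x
    unfolding in_twist_quot_iff using that side_condition neg_in by blast
  show ?thesis
    unfolding embedding_def inj_on_def
    using mem inj imp1 imp2 neg by (auto simp: twist_def)
qed

end

theorem theorem21:
  fixes A :: "'a imp_neg_algebra"
  assumes "sobocinski_algebra A"
  shows "congruence (meet_imp_reduct A) (eqv A)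
    \<and> gen_boolean_algebra (quotient_algebra (meet_imp_reduct A) (eqv A))
    \<and> algebra (twist (quotient_algebra (meet_imp_reduct A) (eqv A)))
    \<and> embeds A (twist (quotient_algebra (meet_imp_reduct A) (eqv A)))"
proof -
  interpret sobocinski A
    using assms by unfold_locales
  show ?thesis
    using congruence_eqv gen_boolean_quot algebra_twist embedding_twist
    unfolding embeds_def by blast
qed

end
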